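(* (1) Let $\alpha$ be irrational and let $q_n$ be the denominator of the $n$-th convergent from the continued fraction expansion of $\alpha$. Then the sequence $(\{(q_n+n)\alpha\})_{n\ge 1}$ is uniformly distributed modulo 1, and every interval of the form $[\{k_1\alpha\},\{k_2\alpha\})$ with $k_1,k_2 \in \mathbb{N}$ and $\{k_1\alpha\} < \{k_2\alpha\}$ is a BRS for this sequence. (2) In general, the sequence $(\{(q_n+n)\alpha\})_{n\ge 1}$ does not have the same collection of BRS as the sequence $(\{n\alpha\})_{n\ge 1}$; that is, there exists an irrational $\alpha$ for which the set of intervals $[a,b)\subseteq[0,1)$ that are BRS for $(\{(q_n+n)\alpha\})_{n\ge 1}$ differs from the set of intervals that are BRS for $(\{n\alpha\})_{n\ge 1}$.
   Context: $\mathbb{N}=\{1,2,\dots\}$; $\{x\}$ denotes the fractional part of $x$. A sequence $(x_n)_{n\ge1}$ in $[0,1)$ is uniformly distributed modulo 1 if $\lim_{N\to\infty}\frac1N\#\{1\le n\le N:x_n\in[a,b)\}=b-a$ for every interval $[a,b)\subseteq[0,1)$. Bounded remainder set (BRS): for a sequence $(x_n)_{n\ge 1}$ in $[0,1)$ and $[a,b)\subseteq[0,1)$ put $D_N([a,b)) = \frac1N\left(\#\{1\le n\le N: x_n\in[a,b)\} - N(b-a)\right)$. The interval $[a,b)$ is a BRS for $(x_n)_{n\geq 1}$ if there is a constant $c$ (independent of $N$) such that $|D_N([a,b))|\le c\,\frac1N$ for all $N\in\mathbb{N}$. Convergents are indexed as usual: for $\alpha=[\alpha_0;\alpha_1,\alpha_2,\dots]$,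 $q_0=1$, $q_1=\alpha_1$, $q_{n}=\alpha_nq_{n-1}+q_{n-2}$ for $n\ge2$. *)

theory Defs
  imports Complex_Main
begin

text \<open>Sequences \<open>(x\<^sub>n)\<close> with \<open>n \<ge> 1\<close> are functions on \<^typ>\<open>nat\<close> whose value at \<open>0\<close> is never used.\<close>

definition visits :: "(nat \<Rightarrow> real) \<Rightarrow> nat \<Rightarrow> real set \<Rightarrow> nat" where
  "visits x N I = card {n \<in> {1..N}. x n \<in> I}"

definition uniformly_distributed_mod1 :: "(nat \<Rightarrow> real) \<Rightarrow> bool" where
  "uniformly_distributed_mod1 x \<longleftrightarrow>
     (\<forall>a b. 0 \<le> a \<and> a < b \<and> b \<le> 1 \<longrightarrow>
        (\<lambda>N. real (visits x N {a..<b}) / real N) \<longlonglongrightarrow> b - a)"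

definition discrepancy :: "(nat \<Rightarrow> real) \<Rightarrow> nat \<Rightarrow> real \<Rightarrow> real \<Rightarrow> real" where
  "discrepancy x N a b = 1 / real N * (real (visits x N {a..<b}) - real N * (b - a))"

definition bounded_remainder :: "(nat \<Rightarrow> real) \<Rightarrow> real \<Rightarrow> real \<Rightarrow> bool" where
  "bounded_remainder x a b \<longleftrightarrow>
     0 \<le> a \<and> a < b \<and> b \<le> 1 \<and>
     (\<exists>c. \<forall>N\<ge>1. \<bar>discrepancy x N a b\<bar> \<le> c * (1 / real N))"

definition bounded_remainder_intervals :: "(nat \<Rightarrow> real) \<Rightarrow> real set set" where
  "bounded_remainder_intervals x = {{a..<b} | a b. bounded_remainder x a b}"

text \<open>
  For irrational \<open>\<alpha>\<close> all complete quotients are irrational, so the divisions below are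
  never by zero and \<open>\<alpha> = [cf_digit \<alpha> 0; cf_digit \<alpha> 1, \<dots>]\<close>.
\<close>

fun complete_quotient :: "real \<Rightarrow> nat \<Rightarrow> real" where
  "complete_quotient \<alpha> 0 = \<alpha>"
| "complete_quotient \<alpha> (Suc n) = 1 / frac (complete_quotient \<alpha> n)"

definition cf_digit :: "real \<Rightarrow> nat \<Rightarrow> int" where
  "cf_digit \<alpha> n = \<lfloor>complete_quotient \<alpha> n\<rfloor>"

fun conv_denom :: "real \<Rightarrow> nat \<Rightarrow> int" where
  "conv_denom \<alpha> 0 = 1"
| "conv_denom \<alpha> (Suc 0) = cf_digit \<alpha> 1"
| "conv_denom \<alpha> (Suc (Suc n)) =
     cf_digit \<alpha> (Suc (Suc n)) * conv_denom \<alpha> (Suc n) + conv_denom \<alpha> n"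

end

theory Submission
  imports Defs "HOL-Analysis.Kronecker_Approximation_Theorem"
begin

text \<open>
  Write \<open>q\<^sub>n\<close> and \<open>p\<^sub>n\<close> for the denominators and numerators of the convergents of \<open>\<alpha>\<close>. Since
  \<open>q\<^sub>n \<alpha> - p\<^sub>n = (-1)\<^sup>n \<epsilon>\<^sub>n\<close> with a tiny \<open>\<epsilon>\<^sub>n > 0\<close>, the point \<open>(q\<^sub>n + n) \<alpha>\<close> is, modulo 1, the orbit
  point \<open>n \<alpha>\<close> displaced by \<open>(-1)\<^sup>n \<epsilon>\<^sub>n\<close>. The displacement changes whether the point lies in
  \<open>[a, b)\<close> only if it carries the point across \<open>a\<close> or \<open>b\<close>, so everything depends on how often such
  crossings happen.

  If the endpoint is \<open>k \<alpha>\<close> with \<open>k \<ge> 1\<close>, a crossing at time \<open>n > k\<close> would bring \<open>(n - k) \<alpha>\<close> within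
  \<open>\<epsilon>\<^sub>n\<close> of an integer. As \<open>1 \<le> n - k < q\<^sub>n\<close>, the best approximation property of convergents
  (\<open>best_approximation\<close>) forbids this. Hence only finitely many visits change, and for the orbit of
  \<open>n \<alpha>\<close> itself the remainder telescopes (\<open>orbit_shift_bounded\<close>). Uniform distribution follows, because
  these endpoints are dense and the frequencies of visits to an arbitrary interval and to its
  complement can both be bounded below by bounded remainder intervals inside them
  (\<open>uniformly_distributed_of_dense_bounded_remainder\<close>).

  For the second part take \<open>\<alpha> = \<surd>2\<close>, where \<open>\<epsilon>\<^sub>n = \<lambda>\<^bsup>n+1\<^esup>\<close> with \<open>\<lambda> = \<surd>2 - 1\<close>. Every interval
  \<open>[a, a + \<lambda>) \<subseteq> [0, 1)\<close> has bounded remainder for \<open>n \<alpha>\<close>, again by telescoping. Choose odd times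
  \<open>h\<^sub>0 = 1\<close>, \<open>h\<^bsub>i+1\<^esub> = h\<^sub>i + q\<^bsub>m\<^esub>\<close> with \<open>m = h\<^sub>i + 2\<close>, and let \<open>a\<close> be the limit of \<open>h\<^sub>i \<alpha>\<close> modulo 1. Then
  \<open>h\<^sub>i \<alpha>\<close> lies just above \<open>a\<close>, at a distance comparable to \<open>\<lambda>\<^bsup>h\<^sub>i+3\<^esup>\<close>, so its downward displacement by
  \<open>\<lambda>\<^bsup>h\<^sub>i+1\<^esup>\<close> moves it out of the interval. Best approximation excludes every other crossing of \<open>a\<close>
  or \<open>a + \<lambda>\<close> at times \<open>n \<ge> 2\<close> (\<open>no_other_crossing\<close>), so one visit is lost at each of the infinitely
  many times \<open>h\<^sub>i\<close>, none is regained, and the remainder is unbounded.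
\<close>

section \<open>Convergents and best approximation\<close>

fun conv_num :: "real \<Rightarrow> nat \<Rightarrow> int" where
  "conv_num \<alpha> 0 = cf_digit \<alpha> 0"
| "conv_num \<alpha> (Suc 0) = cf_digit \<alpha> 1 * cf_digit \<alpha> 0 + 1"
| "conv_num \<alpha> (Suc (Suc n)) =
     cf_digit \<alpha> (Suc (Suc n)) * conv_num \<alpha> (Suc n) + conv_num \<alpha> n"

text \<open>
  For irrational \<open>\<alpha>\<close> this product is the distance \<open>\<bar>q\<^sub>n \<alpha> - p\<^sub>n\<bar>\<close> (see \<open>conv_denom_mult\<close>). In this form its positivity
  and monotonicity are immediate.
\<close>

definition conv_error :: "real \<Rightarrow> nat \<Rightarrow> real" where
  "conv_error \<alpha> n = (\<Prod>i\<le>n. frac (complete_quotient \<alpha> i))"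

lemma complete_quotient_irrational:
  assumes "\<alpha> \<notin> \<rat>"
  shows "complete_quotient \<alpha> n \<notin> \<rat>"
proof (induction n)
  case (Suc n)
  have "frac (complete_quotient \<alpha> n) \<notin> \<rat>"
  proof
    assume "frac (complete_quotient \<alpha> n) \<in> \<rat>"
    then have "frac (complete_quotient \<alpha> n) + of_int \<lfloor>complete_quotient \<alpha> n\<rfloor> \<in> \<rat>"
      by (intro Rats_add) auto
    then show False using Suc by (simp add: frac_def)
  qed
  then show ?case
    using Rats_inverse[of "complete_quotient \<alpha> (Suc n)"] by (auto simp: field_simps)
qed (use assms in auto)

lemma frac_complete_quotient_pos:
  assumes "\<alpha> \<notin> \<rat>"
  shows "frac (complete_quotient \<alpha> n) > 0"
  using complete_quotient_irrational[OF assms, of n] Ints_subset_Rats by auto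

lemma cf_digit_ge_1:
  assumes "\<alpha> \<notin> \<rat>"
  shows "cf_digit \<alpha> (Suc n) \<ge> 1"
  using frac_complete_quotient_pos[OF assms, of n] frac_lt_1[of "complete_quotient \<alpha> n"]
  by (simp add: cf_digit_def le_floor_iff)

lemma conv_denom_ge:
  assumes "\<alpha> \<notin> \<rat>"
  shows "conv_denom \<alpha> n \<ge> 1 \<and> conv_denom \<alpha> n \<ge> int n"
proof (induction n rule: induct_nat_012)
  case (ge2 n)
  have "1 * conv_denom \<alpha> (Suc n) \<le> cf_digit \<alpha> (Suc (Suc n)) * conv_denom \<alpha> (Suc n)"
    using cf_digit_ge_1[OF assms] ge2 by (intro mult_right_mono) auto
  then show ?case unfolding conv_denom.simps using ge2 by (intro conjI; linarith)
qed (use cf_digit_ge_1[OF assms, of 0] in auto)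

lemma conv_error_pos:
  assumes "\<alpha> \<notin> \<rat>"
  shows "conv_error \<alpha> n > 0"
  unfolding conv_error_def by (intro prod_pos) (auto simp: frac_complete_quotient_pos[OF assms] simp del: frac_gt_0_iff)

lemma conv_error_decreasing:
  assumes "\<alpha> \<notin> \<rat>"
  shows "conv_error \<alpha> (Suc n) < conv_error \<alpha> n"
proof -
  have "conv_error \<alpha> (Suc n) = conv_error \<alpha> n * frac (complete_quotient \<alpha> (Suc n))"
    by (simp add: conv_error_def)
  then show ?thesis
    using conv_error_pos[OF assms, of n] frac_lt_1[of "complete_quotient \<alpha> (Suc n)"] by simp
qed

text \<open>
  The left-hand sides and the numerators satisfy the recursion \<open>x\<^bsub>n+2\<^esub> = a\<^bsub>n+2\<^esub> x\<^bsub>n+1\<^esub> + x\<^sub>n\<close>. The signed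
  errors satisfy it too, because \<open>\<epsilon>\<^sub>n = \<epsilon>\<^bsub>n+1\<^esub> \<xi>\<^bsub>n+2\<^esub>\<close> for the complete quotient \<open>\<xi>\<^bsub>n+2\<^esub>\<close>, and removing
  its integer part \<open>a\<^bsub>n+2\<^esub>\<close> leaves \<open>\<epsilon>\<^bsub>n+2\<^esub> = \<epsilon>\<^sub>n - a\<^bsub>n+2\<^esub> \<epsilon>\<^bsub>n+1\<^esub>\<close>.
\<close>

lemma conv_denom_mult:
  assumes "\<alpha> \<notin> \<rat>"
  shows "of_int (conv_denom \<alpha> n) * \<alpha> = of_int (conv_num \<alpha> n) + (-1) ^ n * conv_error \<alpha> n"
proof (induction n rule: induct_nat_012)
  case 0
  then show ?case by (simp add: conv_error_def cf_digit_def frac_def)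
next
  case 1
  have "frac \<alpha> * complete_quotient \<alpha> 1 = 1"
    using frac_complete_quotient_pos[OF assms, of 0] by simp
  then show ?case
    by (simp add: conv_error_def cf_digit_def frac_def algebra_simps)
next
  case (ge2 n)
  let ?\<xi> = "complete_quotient \<alpha>" and ?a = "of_int (cf_digit \<alpha> (Suc (Suc n))) :: real"
  have "frac (?\<xi> (Suc n)) * ?\<xi> (Suc (Suc n)) = 1"
    using frac_complete_quotient_pos[OF assms, of "Suc n"] by simp
  then have step: "conv_error \<alpha> n = conv_error \<alpha> (Suc n) * ?\<xi> (Suc (Suc n))"
    by (simp add: conv_error_def mult.assoc del: complete_quotient.simps)
  have "conv_error \<alpha> (Suc (Suc n)) = conv_error \<alpha> (Suc n) * (?\<xi> (Suc (Suc n)) - ?a)"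
    by (simp add: conv_error_def cf_digit_def frac_def del: complete_quotient.simps)
  also have "\<dots> = conv_error \<alpha> n - ?a * conv_error \<alpha> (Suc n)"
    using step by (simp add: algebra_simps del: complete_quotient.simps)
  finally have err: "conv_error \<alpha> (Suc (Suc n)) = conv_error \<alpha> n - ?a * conv_error \<alpha> (Suc n)" .
  have "of_int (conv_denom \<alpha> (Suc (Suc n))) * \<alpha>
      = ?a * (of_int (conv_denom \<alpha> (Suc n)) * \<alpha>) + of_int (conv_denom \<alpha> n) * \<alpha>"
    by (simp add: algebra_simps)
  then show ?case unfolding ge2 err by (simp add: algebra_simps)
qed

lemma conv_det:
  "conv_num \<alpha> (Suc n) * conv_denom \<alpha> n - conv_num \<alpha> n * conv_denom \<alpha> (Suc n) = (-1) ^ n"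
proof (induction n)
  case (Suc n)
  then show ?case by (simp add: algebra_simps)
qed auto

text \<open>
  Two consecutive convergents form a basis of the integer lattice, so
  \<open>(m, p) = x (q\<^bsub>n+1\<^esub>, p\<^bsub>n+1\<^esub>) + y (q\<^sub>n, p\<^sub>n)\<close> with integers \<open>x\<close>, \<open>y\<close>. The bounds on \<open>m\<close> force \<open>y \<noteq> 0\<close>
  and forbid \<open>x\<close> and \<open>y\<close> to have the same sign. As the errors of the two convergents have opposite
  signs, the two contributions to \<open>m \<alpha> - p\<close> add up in absolute value.
\<close>

lemma best_approximation:
  fixes m p :: int
  assumes irr: "\<alpha> \<notin> \<rat>" and m: "1 \<le> m" "m < conv_denom \<alpha> (Suc n)"
  shows "\<bar>of_int m * \<alpha> - of_int p\<bar> \<ge> conv_error \<alpha> n"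
proof -
  let ?q0 = "conv_denom \<alpha> n" and ?q1 = "conv_denom \<alpha> (Suc n)"
  let ?p0 = "conv_num \<alpha> n" and ?p1 = "conv_num \<alpha> (Suc n)"
  let ?e0 = "conv_error \<alpha> n" and ?e1 = "conv_error \<alpha> (Suc n)"
  \<comment> \<open>Cramer's rule for the coordinates, with determinant \<open>D = \<plusminus>1\<close>.\<close>
  define D :: int where "D = (-1) ^ n"
  define x where "x = D * (p * ?q0 - ?p0 * m)"
  define y where "y = D * (?p1 * m - p * ?q1)"
  have D: "D * (?p1 * ?q0 - ?p0 * ?q1) = 1"
    unfolding conv_det D_def by (simp flip: power_mult_distrib)
  have q: "?q0 \<ge> 1" "?q1 \<ge> 1" using conv_denom_ge[OF irr] by auto
  have "x * ?q1 + y * ?q0 = m * (D * (?p1 * ?q0 - ?p0 * ?q1))"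
    unfolding x_def y_def by (simp add: algebra_simps)
  then have mxy: "m = x * ?q1 + y * ?q0" using D by simp
  have "x * ?p1 + y * ?p0 = p * (D * (?p1 * ?q0 - ?p0 * ?q1))"
    unfolding x_def y_def by (simp add: algebra_simps)
  then have pxy: "p = x * ?p1 + y * ?p0" using D by simp
  have "of_int m * \<alpha> - of_int p
      = of_int x * (of_int ?q1 * \<alpha> - of_int ?p1) + of_int y * (of_int ?q0 * \<alpha> - of_int ?p0)"
    unfolding mxy pxy by (simp add: algebra_simps)
  also have "\<dots> = (-1) ^ n * (of_int y * ?e0 - of_int x * ?e1)"
    unfolding conv_denom_mult[OF irr] by (simp add: algebra_simps)
  finally have abs: "\<bar>of_int m * \<alpha> - of_int p\<bar> = \<bar>of_int y * ?e0 - of_int x * ?e1\<bar>"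
    by (simp add: abs_mult)
  have e: "?e0 > 0" "?e1 > 0" using conv_error_pos[OF irr] by auto
  consider "y = 0" | "y \<ge> 1" | "y \<le> -1" by linarith
  then show ?thesis
  proof cases
    case 1
    then have "m = x * ?q1" using mxy by simp
    then have "x \<ge> 1" using m q by (smt (verit) mult_nonpos_nonneg)
    then have "x * ?q1 \<ge> 1 * ?q1" using q by (intro mult_right_mono) auto
    then show ?thesis using \<open>m = x * ?q1\<close> m by linarith
  next
    case 2
    have "x \<le> 0"
    proof (rule ccontr)
      assume "\<not> x \<le> 0"
      then have "x * ?q1 \<ge> 1 * ?q1" using q by (intro mult_right_mono) auto
      moreover have "y * ?q0 \<ge> 0" using 2 q by simp
      ultimately show False using mxy m by linarith
    qed
    then have "of_int x * ?e1 \<le> 0" using e by (simp add: mult_nonpos_nonneg)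
    moreover have "of_int y * ?e0 \<ge> 1 * ?e0" using 2 e by (intro mult_right_mono) auto
    ultimately show ?thesis unfolding abs by linarith
  next
    case 3
    have "x \<ge> 0"
    proof (rule ccontr)
      assume "\<not> x \<ge> 0"
      then have "x * ?q1 \<le> 0" using q by (simp add: mult_nonpos_nonneg)
      moreover have "y * ?q0 \<le> 0" using 3 q by (simp add: mult_nonpos_nonneg)
      ultimately show False using mxy m by linarith
    qed
    then have "of_int x * ?e1 \<ge> 0" using e by simp
    moreover have "of_int y * ?e0 \<le> (-1) * ?e0"
    proof (intro mult_right_mono)
      show "(of_int y :: real) \<le> -1" using 3 by linarith
    qed (use e in auto)
    ultimately show ?thesis unfolding abs by linarith
  qed
qed

section \<open>Visits as sums of fractional parts\<close>

lemma frac_diff_unit: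
  fixes t c :: real
  assumes "0 \<le> c" "c \<le> 1"
  shows "frac (t - c) = frac t - c + of_bool (frac t < c)"
proof -
  have "t - c - (frac t - c + of_bool (frac t < c)) = of_int (\<lfloor>t\<rfloor> - of_bool (frac t < c))"
    by (simp add: frac_def)
  then have "t - c - (frac t - c + of_bool (frac t < c)) \<in> \<int>" by (metis Ints_of_int)
  then show ?thesis
    unfolding frac_unique_iff using assms frac_lt_1[of t] frac_ge_0[of t]
    by (auto simp del: frac_ge_0)
qed

text \<open>
  Deciding \<open>frac t \<in> [a, b)\<close> amounts to comparing the integer parts of \<open>t - a\<close> and \<open>t - b\<close>. Written
  with fractional parts, the comparison isolates the expected value \<open>b - a\<close>, and what is left over
  is a sum that can telescope.
\<close>

lemma visits_frac_eq:
  assumes "0 \<le> a" "a < b" "b \<le> 1"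
  shows "real (visits (\<lambda>n. frac (t n)) N {a..<b}) - real N * (b - a)
       = (\<Sum>n=1..N. frac (t n - b) - frac (t n - a))"
proof -
  have "real (visits (\<lambda>n. frac (t n)) N {a..<b}) = (\<Sum>n=1..N. of_bool (frac (t n) \<in> {a..<b}))"
    unfolding visits_def
    by (simp add: sum.If_cases of_bool_def Int_def conj_commute)
  also have "\<dots> = (\<Sum>n=1..N. (frac (t n - b) - frac (t n - a)) + (b - a))"
    by (intro sum.cong refl) (use assms in \<open>auto simp: frac_diff_unit\<close>)
  also have "\<dots> = (\<Sum>n=1..N. frac (t n - b) - frac (t n - a)) + real N * (b - a)"
    by (subst sum.distrib) simp
  finally show ?thesis by simp
qed

lemma bounded_remainder_frac_iff:
  "bounded_remainder (\<lambda>n. frac (t n)) a b \<longleftrightarrow> 0 \<le> a \<and> a < b \<and> b \<le> 1 \<and>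
     (\<exists>c. \<forall>N\<ge>1. \<bar>\<Sum>n=1..N. frac (t n - b) - frac (t n - a)\<bar> \<le> c)"
proof -
  have "\<bar>discrepancy x N a b\<bar> \<le> c * (1 / real N) \<longleftrightarrow>
      \<bar>real (visits x N {a..<b}) - real N * (b - a)\<bar> \<le> c" if "N \<ge> 1" for x N c
    using that by (simp add: discrepancy_def abs_mult divide_simps)
  then show ?thesis
    unfolding bounded_remainder_def using visits_frac_eq[of a b t] by (auto cong: conj_cong)
qed

lemma frac_add_small:
  fixes t d :: real
  assumes "\<And>p::int. \<bar>t - of_int p\<bar> > \<bar>d\<bar>"
  shows "frac (t + d) = frac t + d"
proof -
  have "\<bar>t - of_int \<lfloor>t\<rfloor>\<bar> > \<bar>d\<bar>" "\<bar>t - of_int (\<lfloor>t\<rfloor> + 1)\<bar> > \<bar>d\<bar>" by (rule assms)+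
  then have "0 \<le> frac t + d" "frac t + d < 1"
    using frac_lt_1[of t] frac_ge_0[of t] by (auto simp: frac_def)
  moreover have "t + d - (frac t + d) \<in> \<int>" by (simp add: frac_def)
  ultimately show ?thesis by (simp add: frac_unique_iff)
qed

section \<open>Intervals with endpoints in the orbit\<close>

text \<open>
  As \<open>q\<^sub>n \<ge> n\<close>, the difference \<open>n - k\<close> is a positive integer below \<open>q\<^sub>n\<close>, hence \<open>(n - k) \<alpha>\<close> is at least \<open>\<epsilon>\<^bsub>n-1\<^esub> > \<epsilon>\<^sub>n\<close> away from
  every integer, and the displacement causes no wrap-around. The displacement does not depend
  on \<open>k\<close>, so it cancels when two endpoints are compared.
\<close>

lemma frac_perturbed_orbit:
  assumes irr: "\<alpha> \<notin> \<rat>" and k: "1 \<le> k" "k < n"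
  shows "frac (real_of_int (conv_denom \<alpha> n + int n) * \<alpha> - real k * \<alpha>)
       = frac ((real n - real k) * \<alpha>) + (-1) ^ n * conv_error \<alpha> n"
proof -
  obtain n' where n': "n = Suc n'" using k by (cases n) auto
  have "\<bar>(real n - real k) * \<alpha> - of_int p\<bar> > \<bar>(-1) ^ n * conv_error \<alpha> n\<bar>" for p :: int
  proof -
    have "\<bar>of_int (int n - int k) * \<alpha> - of_int p\<bar> \<ge> conv_error \<alpha> n'"
      using k conv_denom_ge[OF irr, of n] by (intro best_approximation irr) (auto simp: n')
    then show ?thesis
      using conv_error_decreasing[OF irr, of n'] conv_error_pos[OF irr, of n]
      by (simp add: abs_mult n')
  qed
  then have "frac ((real n - real k) * \<alpha> + (-1) ^ n * conv_error \<alpha> n)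
      = frac ((real n - real k) * \<alpha>) + (-1) ^ n * conv_error \<alpha> n"
    by (rule frac_add_small)
  moreover have "real_of_int (conv_denom \<alpha> n + int n) * \<alpha> - real k * \<alpha>
      = ((real n - real k) * \<alpha> + (-1) ^ n * conv_error \<alpha> n) + of_int (conv_num \<alpha> n)"
    using conv_denom_mult[OF irr, of n] by (simp add: algebra_simps)
  ultimately show ?thesis by (simp only: frac_add_of_int_right)
qed

text \<open>
  Raising \<open>k\<close> by one changes the sum by only two boundary terms, whose difference is at most 1.
\<close>

lemma orbit_shift_bounded:
  "\<bar>\<Sum>n=1..N. frac ((real n - real k) * \<alpha>) - frac (real n * \<alpha>)\<bar> \<le> real k"
proof (induction k)
  case (Suc k)
  have "(\<Sum>n=1..N. frac ((real n - real (Suc k)) * \<alpha>) - frac ((real n - real k) * \<alpha>))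
      = frac ((0 - real k) * \<alpha>) - frac ((real N - real k) * \<alpha>)"
    by (induction N) (auto simp: algebra_simps)
  moreover have "\<bar>frac x - frac y\<bar> \<le> 1" for x y :: real
    using frac_lt_1[of x] frac_lt_1[of y] frac_ge_0[of x] frac_ge_0[of y] by linarith
  ultimately have
    "\<bar>\<Sum>n=1..N. frac ((real n - real (Suc k)) * \<alpha>) - frac ((real n - real k) * \<alpha>)\<bar> \<le> 1"
    by presburger
  then show ?case using Suc by (simp add: sum_subtractf del: of_nat_Suc)
qed auto

text \<open>
  Beyond \<open>max k1 k2\<close> the summands for the displaced orbit agree with those for the orbit of \<open>n \<alpha>\<close>,
  whose sums are bounded by telescoping.
\<close>

lemma bounded_remainder_perturbed_orbit:
  assumes irr: "\<alpha> \<notin> \<rat>" and k: "1 \<le> k1" "1 \<le> k2"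
    and less: "frac (real k1 * \<alpha>) < frac (real k2 * \<alpha>)"
  shows "bounded_remainder (\<lambda>n. frac (real_of_int (conv_denom \<alpha> n + int n) * \<alpha>))
           (frac (real k1 * \<alpha>)) (frac (real k2 * \<alpha>))"
proof -
  let ?t = "\<lambda>n. real_of_int (conv_denom \<alpha> n + int n) * \<alpha>"
  let ?f = "\<lambda>n. frac (?t n - real k2 * \<alpha>) - frac (?t n - real k1 * \<alpha>)"
  let ?g = "\<lambda>n. frac ((real n - real k2) * \<alpha>) - frac ((real n - real k1) * \<alpha>)"
  let ?K = "max k1 k2"
  have "\<bar>\<Sum>n=1..N. ?f n\<bar> \<le> (\<Sum>n=1..?K. \<bar>?f n - ?g n\<bar>) + real k1 + real k2" for N
  proof -
    have "?f n = ?g n" if "n > ?K" for n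
      using frac_perturbed_orbit[OF irr, of k1 n] frac_perturbed_orbit[OF irr, of k2 n] that k
      by simp
    then have "(\<Sum>n=1..N. \<bar>?f n - ?g n\<bar>) \<le> (\<Sum>n=1..?K. \<bar>?f n - ?g n\<bar>)"
      by (intro order.trans
          [OF eq_refl[OF sum.mono_neutral_right[of _ "{1..N} \<inter> {1..?K}"]] sum_mono2])
        (auto simp: not_le)
    moreover have "\<bar>\<Sum>n=1..N. ?f n - ?g n\<bar> \<le> (\<Sum>n=1..N. \<bar>?f n - ?g n\<bar>)" by (rule sum_abs)
    ultimately have "\<bar>(\<Sum>n=1..N. ?f n) - (\<Sum>n=1..N. ?g n)\<bar> \<le> (\<Sum>n=1..?K. \<bar>?f n - ?g n\<bar>)"
      by (simp only: sum_subtractf)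
    moreover have "\<bar>\<Sum>n=1..N. ?g n\<bar> \<le> real k1 + real k2"
      using orbit_shift_bounded[where k=k1 and N=N and \<alpha>=\<alpha>]
        orbit_shift_bounded[where k=k2 and N=N and \<alpha>=\<alpha>]
      by (simp add: sum_subtractf)
    ultimately show ?thesis by linarith
  qed
  then show ?thesis
    unfolding bounded_remainder_frac_iff frac_diff_simp
    using less frac_lt_1[of "real k2 * \<alpha>"] by (auto simp: less_imp_le)
qed

section \<open>Uniform distribution from a dense family of bounded remainder intervals\<close>

lemma bounded_remainder_imp_frequency:
  assumes "bounded_remainder x a b"
  shows "(\<lambda>N. real (visits x N {a..<b}) / real N) \<longlonglongrightarrow> b - a"
proof -
  obtain c where c: "\<And>N. N \<ge> 1 \<Longrightarrow> \<bar>discrepancy x N a b\<bar> \<le> c * (1 / real N)"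
    using assms by (auto simp: bounded_remainder_def)
  have "(\<lambda>N. c * (1 / real N)) \<longlonglongrightarrow> 0"
    using tendsto_mult_right_zero[OF lim_const_over_n[of 1], of c] by simp
  moreover have "eventually (\<lambda>N. norm (discrepancy x N a b) \<le> c * (1 / real N)) sequentially"
    using c by (intro eventually_sequentiallyI[of 1]) auto
  ultimately have "(\<lambda>N. discrepancy x N a b) \<longlonglongrightarrow> 0"
    by (rule Lim_null_comparison[rotated])
  then have "(\<lambda>N. discrepancy x N a b + (b - a)) \<longlonglongrightarrow> 0 + (b - a)"
    by (intro tendsto_intros)
  moreover have "eventually (\<lambda>N. discrepancy x N a b + (b - a)
      = real (visits x N {a..<b}) / real N) sequentially"
    by (intro eventually_sequentiallyI[of 1]) (auto simp: discrepancy_def field_simps)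
  ultimately show ?thesis by (simp add: filterlim_cong)
qed

lemma visits_mono: "I \<subseteq> J \<Longrightarrow> visits x N I \<le> visits x N J"
  unfolding visits_def by (intro card_mono) auto

lemma visits_Un_disjoint:
  assumes "I \<inter> J = {}"
  shows "visits x N (I \<union> J) = visits x N I + visits x N J"
proof -
  have "{n \<in> {1..N}. x n \<in> I \<union> J} = {n \<in> {1..N}. x n \<in> I} \<union> {n \<in> {1..N}. x n \<in> J}" by auto
  then show ?thesis
    unfolding visits_def using assms by (simp only:) (intro card_Un_disjoint, auto)
qed

text \<open>
  A bounded remainder interval just inside \<open>[a, b)\<close> bounds the frequency of visits from below.
  Approximation from outside might leave the unit interval, so the upper bound comes instead from
  the lower bounds for \<open>[0, a)\<close> and \<open>[b, 1)\<close>, because the three frequencies add up to 1.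
\<close>

lemma uniformly_distributed_of_dense_bounded_remainder:
  assumes range: "\<And>n. x n \<in> {0..<1}"
    and dense: "\<And>u v. 0 \<le> u \<Longrightarrow> u < v \<Longrightarrow> v \<le> 1 \<Longrightarrow> \<exists>d\<in>E. u < d \<and> d < v"
    and brs: "\<And>d d'. d \<in> E \<Longrightarrow> d' \<in> E \<Longrightarrow> d < d' \<Longrightarrow> bounded_remainder x d d'"
  shows "uniformly_distributed_mod1 x"
proof -
  let ?F = "\<lambda>a b N. real (visits x N {a..<b}) / real N"
  have lower: "eventually (\<lambda>N. ?F a b N > b - a - \<epsilon>) sequentially"
    if ab: "0 \<le> a" "a \<le> b" "b \<le> 1" and "\<epsilon> > 0" for a b \<epsilon>
  proof (cases "b - a < \<epsilon>")
    case True
    have "b - a - \<epsilon> < ?F a b N" for N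
      by (rule less_le_trans[of _ 0]) (use True in auto)
    then show ?thesis by simp
  next
    case False
    obtain d where d: "d \<in> E" "a < d" "d < a + \<epsilon> / 3"
      using dense[of a "a + \<epsilon> / 3"] False \<open>\<epsilon> > 0\<close> ab by auto
    obtain d' where d': "d' \<in> E" "b - \<epsilon> / 3 < d'" "d' < b"
      using dense[of "b - \<epsilon> / 3" b] False \<open>\<epsilon> > 0\<close> ab by auto
    have "d < d'" using d d' False \<open>\<epsilon> > 0\<close> by linarith
    then have "?F d d' \<longlonglongrightarrow> d' - d"
      using d d' by (intro bounded_remainder_imp_frequency brs)
    moreover have "d' - d > b - a - \<epsilon>" using d d' \<open>\<epsilon> > 0\<close> by linarith
    ultimately have "eventually (\<lambda>N. ?F d d' N > b - a - \<epsilon>) sequentially"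
      by (rule order_tendstoD)
    then show ?thesis
    proof eventually_elim
      case (elim N)
      have "visits x N {d..<d'} \<le> visits x N {a..<b}" using d d' by (intro visits_mono) auto
      then have "?F d d' N \<le> ?F a b N" by (intro divide_right_mono) auto
      then show ?case using elim by linarith
    qed
  qed
  have "?F a b \<longlonglongrightarrow> b - a" if ab: "0 \<le> a" "a < b" "b \<le> 1" for a b
  proof (rule order_tendstoI)
    fix l assume "l < b - a"
    then show "eventually (\<lambda>N. l < ?F a b N) sequentially"
      using lower[of a b "b - a - l"] ab by simp
  next
    fix u assume u: "b - a < u"
    define \<epsilon> where "\<epsilon> = (u - (b - a)) / 2"
    have "\<epsilon> > 0" using u by (simp add: \<epsilon>_def)
    have "eventually (\<lambda>N. ?F 0 a N > a - 0 - \<epsilon>) sequentially"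
      "eventually (\<lambda>N. ?F b 1 N > 1 - b - \<epsilon>) sequentially"
      using ab \<open>\<epsilon> > 0\<close> lower[of 0 a] lower[of b 1] by auto
    then show "eventually (\<lambda>N. ?F a b N < u) sequentially"
      using eventually_ge_at_top[of 1]
    proof eventually_elim
      case (elim N)
      have "visits x N ({0..<a} \<union> ({a..<b} \<union> {b..<1}))
          = visits x N {0..<a} + (visits x N {a..<b} + visits x N {b..<1})"
        using ab by (subst visits_Un_disjoint, force)+ simp
      moreover have "{0..<a} \<union> ({a..<b} \<union> {b..<1}) = {0..<1::real}" using ab by auto
      moreover have "{n \<in> {1..N}. x n \<in> {0..<1}} = {1..N}" using range by blast
      then have "visits x N {0..<1} = N"
        by (simp only: visits_def card_atLeastAtMost diff_Suc_1)
      ultimately have "N = visits x N {0..<a} + (visits x N {a..<b} + visits x N {b..<1})"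
        by metis
      then have "real (visits x N {0..<a}) + real (visits x N {a..<b})
          + real (visits x N {b..<1}) = real N" by linarith
      then have "?F 0 a N + ?F a b N + ?F b 1 N = 1"
        using elim(3) by (simp flip: add_divide_distrib)
      then show ?case using elim(1,2) unfolding \<epsilon>_def by argo
    qed
  qed
  then show ?thesis by (auto simp: uniformly_distributed_mod1_def)
qed

lemma orbit_dense:
  assumes irr: "\<alpha> \<notin> \<rat>" and uv: "0 \<le> u" "u < v" "v \<le> 1"
  shows "\<exists>k\<ge>1. u < frac (real k * \<alpha>) \<and> frac (real k * \<alpha>) < v"
proof -
  obtain k where "k > 0" "\<bar>frac (real k * \<alpha>) - (u + v) / 2\<bar> < (v - u) / 2"
    using Kronecker_approx_1_explicit[OF irr, of "(u + v) / 2" "(v - u) / 2"] uv by auto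
  then show ?thesis by (intro exI[of _ k]) (auto simp: abs_if field_simps split: if_splits)
qed

lemma uniformly_distributed_perturbed_orbit:
  assumes irr: "\<alpha> \<notin> \<rat>"
  shows "uniformly_distributed_mod1 (\<lambda>n. frac (real_of_int (conv_denom \<alpha> n + int n) * \<alpha>))"
proof (rule uniformly_distributed_of_dense_bounded_remainder
    [where E = "{frac (real k * \<alpha>) | k. k \<ge> 1}"])
  fix u v :: real
  assume "0 \<le> u" "u < v" "v \<le> 1"
  then show "\<exists>d\<in>{frac (real k * \<alpha>) | k. k \<ge> 1}. u < d \<and> d < v"
    using orbit_dense[OF irr] by blast
next
  fix d d'
  assume "d \<in> {frac (real k * \<alpha>) | k. k \<ge> 1}" "d' \<in> {frac (real k * \<alpha>) | k. k \<ge> 1}" "d < d'"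
  then show "bounded_remainder (\<lambda>n. frac (real_of_int (conv_denom \<alpha> n + int n) * \<alpha>)) d d'"
    using bounded_remainder_perturbed_orbit[OF irr] by blast
qed (auto simp: frac_lt_1)


section \<open>An interval that fails for the square root of two\<close>

definition silver :: real where "silver = sqrt 2 - 1"

lemma silver_square: "silver\<^sup>2 = 1 - 2 * silver"
  by (simp add: silver_def power2_eq_square algebra_simps)

lemma silver_bounds: "2 / 5 < silver" "silver < 1 / 2"
proof -
  have "7 / 5 < sqrt 2" by (rule real_less_rsqrt) (simp add: power2_eq_square)
  moreover have "sqrt 2 < 3 / 2" by (rule real_less_lsqrt) (auto simp: power2_eq_square)
  ultimately show "2 / 5 < silver" "silver < 1 / 2" by (auto simp: silver_def)
qed

lemma silver_power_antimono: "i \<le> j \<Longrightarrow> silver ^ j \<le> silver ^ i"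
  using silver_bounds by (intro power_decreasing) auto

lemma silver_power_pos: "silver ^ i > 0"
  using silver_bounds by simp

lemma sqrt2_irrational: "sqrt 2 \<notin> \<rat>"
proof
  assume "sqrt 2 \<in> \<rat>"
  then obtain m n :: nat where mn: "n \<noteq> 0" "\<bar>sqrt 2\<bar> = real m / real n" "coprime m n"
    by (rule Rats_abs_nat_div_natE)
  then have "real m = sqrt 2 * real n" by (simp add: field_simps)
  then have "(real m)\<^sup>2 = (sqrt 2 * real n)\<^sup>2" by simp
  then have "real (m\<^sup>2) = real (2 * n\<^sup>2)" by (simp add: power_mult_distrib)
  then have eq: "m\<^sup>2 = 2 * n\<^sup>2" by (simp only: of_nat_eq_iff)
  then have "even m" by (metis dvd_triv_left even_power pos2)
  then obtain k where "m = 2 * k" by auto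
  then have "n\<^sup>2 = 2 * k\<^sup>2" using eq by (simp add: power2_eq_square)
  then have "even n" by (metis dvd_triv_left even_power pos2)
  then show False using \<open>even m\<close> mn(3) by auto
qed

lemma complete_quotient_sqrt2: "complete_quotient (sqrt 2) (Suc n) = silver + 2"
proof (induction n)
  have *: "1 / silver = silver + 2"
    using silver_bounds silver_square by (simp add: field_simps power2_eq_square)
  have "frac (sqrt 2) = silver" "frac (silver + 2) = silver"
    using silver_bounds by (auto simp: frac_unique_iff silver_def)
  note ** = this
  { case 0 show ?case using * ** by simp }
  { case (Suc n) then show ?case using * ** by simp }
qed

lemma frac_complete_quotient_sqrt2: "frac (complete_quotient (sqrt 2) n) = silver"
proof (cases n)
  case 0
  then show ?thesis using silver_bounds by (auto simp: frac_unique_iff silver_def)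
next
  case (Suc k)
  then show ?thesis using silver_bounds
    by (auto simp: complete_quotient_sqrt2 frac_unique_iff simp del: complete_quotient.simps)
qed

lemma conv_error_sqrt2: "conv_error (sqrt 2) n = silver ^ Suc n"
  by (simp add: conv_error_def frac_complete_quotient_sqrt2)

lemma cf_digit_sqrt2: "cf_digit (sqrt 2) (Suc n) = 2"
proof -
  have "\<lfloor>silver + 2\<rfloor> = 2" using silver_bounds by (intro floor_unique) auto
  then show ?thesis by (simp add: cf_digit_def complete_quotient_sqrt2 del: complete_quotient.simps)
qed

lemma even_conv_denom_sqrt2: "even (conv_denom (sqrt 2) n) \<longleftrightarrow> odd n"
  by (induction n rule: induct_nat_012) (use cf_digit_sqrt2 in auto)

lemma conv_denom_sqrt2_mult:
  "of_int (conv_denom (sqrt 2) n) * sqrt 2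
     = of_int (conv_num (sqrt 2) n) + (-1) ^ n * silver ^ Suc n"
  using conv_denom_mult[OF sqrt2_irrational] conv_error_sqrt2 by simp

text \<open>
  The times at which a displaced point will leave the interval. They are odd, so that the
  displacement is downwards; the summand is even because \<open>q\<^sub>m\<close> is even for odd \<open>m\<close>. Advancing by
  \<open>q\<^sub>m\<close> with \<open>m\<close> odd moves the orbit point down by \<open>\<lambda>\<^bsup>m+1\<^esup>\<close>, and \<open>m = h\<^sub>i + 2\<close> is the least odd \<open>m\<close> for
  which all later moves together stay below the displacement \<open>\<lambda>\<^bsup>h\<^sub>i+1\<^esup>\<close> at time \<open>h\<^sub>i\<close>.
\<close>

fun crossing :: "nat \<Rightarrow> nat" where
  "crossing 0 = 1"
| "crossing (Suc i) = crossing i + nat (conv_denom (sqrt 2) (crossing i + 2))"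

lemma int_crossing_Suc: "int (crossing (Suc i)) = int (crossing i) + conv_denom (sqrt 2) (crossing i + 2)"
  using conv_denom_ge[OF sqrt2_irrational, of "crossing i + 2"] by simp

lemma crossing_Suc_ge: "crossing (Suc i) \<ge> crossing i + 2"
  using int_crossing_Suc[of i] conv_denom_ge[OF sqrt2_irrational, of "crossing i + 2"] by linarith

lemma crossing_ge: "crossing (i + j) \<ge> crossing i + 2 * j"
proof (induction j)
  case (Suc j)
  then show ?case using crossing_Suc_ge[of "i + j"] by (simp del: crossing.simps)
qed auto

lemma crossing_pos: "crossing i \<ge> 1"
  using crossing_ge[of 0 i] by simp

lemma odd_crossing: "odd (crossing i)"
proof (induction i)
  case (Suc i)
  have "even (conv_denom (sqrt 2) (crossing i + 2))" using Suc by (simp add: even_conv_denom_sqrt2 del: conv_denom.simps)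
  then show ?case using Suc int_crossing_Suc[of i] by (metis even_add even_of_nat)
qed auto

lemma between_crossings:
  assumes "m \<ge> 1"
  shows "\<exists>i. crossing i \<le> m \<and> m < crossing (Suc i)"
  using assms
proof (induction m rule: dec_induct)
  case base
  show ?case using crossing_Suc_ge[of 0] by (intro exI[of _ 0]) auto
next
  case (step m)
  then obtain i where i: "crossing i \<le> m" "m < crossing (Suc i)" by blast
  show ?case
  proof (cases "Suc m < crossing (Suc i)")
    case True
    then show ?thesis using i by (intro exI[of _ i]) auto
  next
    case False
    then show ?thesis using i crossing_Suc_ge[of "Suc i"] by (intro exI[of _ "Suc i"]) auto
  qed
qed

text \<open>
  The total distance that the orbit still descends after time \<open>h\<^sub>i\<close>, which is its height above the
  limit point at that time (see \<open>orbit_frac_crossing\<close>).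
\<close>

definition crossing_tail :: "nat \<Rightarrow> real" where
  "crossing_tail i = (\<Sum>j. silver ^ (crossing (i + j) + 3))"

lemma crossing_tail_term_le: "silver ^ (crossing (i + j) + 3) \<le> silver ^ (crossing i + 3) * (silver\<^sup>2) ^ j"
proof -
  have "silver ^ (crossing (i + j) + 3) \<le> silver ^ (crossing i + 3 + 2 * j)"
    using crossing_ge[of i j] by (intro silver_power_antimono) simp
  then show ?thesis by (simp add: power_add power_mult)
qed

lemma silver_geometric: "(\<lambda>j. (silver\<^sup>2) ^ j) sums (1 / (2 * silver))"
proof -
  have "norm (silver\<^sup>2) < 1" using silver_bounds by (simp add: abs_square_less_1)
  then have "(\<lambda>j. (silver\<^sup>2) ^ j) sums (1 / (1 - silver\<^sup>2))" by (rule geometric_sums)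
  then show ?thesis by (simp add: silver_square)
qed

lemma summable_crossing_tail: "summable (\<lambda>j. silver ^ (crossing (i + j) + 3))"
proof (rule summable_comparison_test)
  show "\<exists>N. \<forall>j\<ge>N. norm (silver ^ (crossing (i + j) + 3)) \<le> silver ^ (crossing i + 3) * (silver\<^sup>2) ^ j"
    using crossing_tail_term_le silver_power_pos by (simp add: less_imp_le)
  show "summable (\<lambda>j. silver ^ (crossing i + 3) * (silver\<^sup>2) ^ j)"
    using silver_geometric by (intro summable_mult) (rule sums_summable)
qed

lemma crossing_tail_rec: "crossing_tail i = silver ^ (crossing i + 3) + crossing_tail (Suc i)"
  using suminf_split_head[OF summable_crossing_tail[of i]]
  by (simp add: crossing_tail_def del: crossing.simps)

lemma crossing_tail_pos: "crossing_tail i > 0"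
  unfolding crossing_tail_def by (intro suminf_pos summable_crossing_tail silver_power_pos)

text \<open>
  The series is dominated by a geometric one with ratio \<open>\<lambda>\<^sup>2\<close>, and \<open>1 - \<lambda>\<^sup>2 = 2 \<lambda>\<close>. The factor
  \<open>1/2\<close> matters below, since it is less than \<open>1 - \<lambda>\<close>.
\<close>

lemma crossing_tail_le: "crossing_tail i \<le> silver ^ (crossing i + 2) / 2"
proof -
  have "(\<lambda>j. silver ^ (crossing i + 3) * (silver\<^sup>2) ^ j) sums (silver ^ (crossing i + 3) * (1 / (2 * silver)))"
    using silver_geometric by (rule sums_mult)
  also have "silver ^ (crossing i + 3) * (1 / (2 * silver)) = silver ^ (crossing i + 2) / 2"
    using silver_bounds by (simp add: power_add eval_nat_numeral)
  finally show ?thesis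
    unfolding crossing_tail_def using crossing_tail_term_le summable_crossing_tail by (intro sums_le[OF _ summable_sums]) auto
qed

text \<open>
  The limit modulo 1 of \<open>h\<^sub>i \<surd>2\<close>: at the first time \<open>h\<^sub>0 = 1\<close> the orbit is at \<open>\<lambda>\<close>, and from there it
  descends by \<open>crossing_tail 0\<close> in total.
\<close>

definition left_end :: real where
  "left_end = silver - crossing_tail 0"

lemma left_end_bounds: "0 \<le> left_end" "left_end \<le> silver"
proof -
  have "silver ^ 3 \<le> silver" using silver_power_antimono[of 1 3] by simp
  moreover have "crossing_tail 0 \<le> silver ^ 3 / 2" using crossing_tail_le[of 0] by (simp add: eval_nat_numeral)
  ultimately show "0 \<le> left_end" "left_end \<le> silver"
    using crossing_tail_pos[of 0] silver_bounds unfolding left_end_def by linarith+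
qed

text \<open>
  Advancing from \<open>h\<^sub>i\<close> to \<open>h\<^bsub>i+1\<^esub>\<close> lowers the orbit point by the leading term of the tail.
\<close>

lemma crossing_orbit: "\<exists>p::int. real (crossing i) * sqrt 2 - left_end = of_int p + crossing_tail i"
proof (induction i)
  case 0
  show ?case by (intro exI[of _ 1]) (simp add: left_end_def silver_def)
next
  case (Suc i)
  then obtain p :: int where p: "real (crossing i) * sqrt 2 - left_end = of_int p + crossing_tail i" by blast
  have "real (crossing (Suc i)) = real (crossing i) + of_int (conv_denom (sqrt 2) (crossing i + 2))"
    using int_crossing_Suc[of i] by (metis of_int_add of_int_of_nat_eq)
  then have "real (crossing (Suc i)) * sqrt 2 - left_end
      = (real (crossing i) * sqrt 2 - left_end) + of_int (conv_denom (sqrt 2) (crossing i + 2)) * sqrt 2"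
    by (simp add: algebra_simps del: crossing.simps)
  also have "\<dots> = of_int p + crossing_tail i + (of_int (conv_num (sqrt 2) (crossing i + 2)) - silver ^ (crossing i + 3))"
    unfolding p conv_denom_sqrt2_mult using odd_crossing[of i] by (simp add: eval_nat_numeral)
  also have "\<dots> = of_int (p + conv_num (sqrt 2) (crossing i + 2)) + crossing_tail (Suc i)"
    using crossing_tail_rec[of i] by simp
  finally show ?case by blast
qed

text \<open>
  With \<open>h\<^sub>i < m < h\<^bsub>i+1\<^esub>\<close> the difference \<open>k = m - h\<^sub>i\<close> is positive and below the denominator of index
  \<open>h\<^sub>i + 2\<close>. Best approximation keeps \<open>k \<surd>2\<close> at least \<open>\<lambda>\<^bsup>h\<^sub>i+2\<^esup>\<close> away from the integers, and at most half
  of that is lost by moving from \<open>h\<^sub>i \<surd>2\<close> to the limit point. The rest exceeds the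
  displacement if \<open>m \<ge> h\<^sub>i + 2\<close>. For \<open>m = h\<^sub>i + 1\<close> the displacement is as large as \<open>\<lambda>\<^bsup>h\<^sub>i+2\<^esup>\<close> itself, but
  then \<open>k = 1\<close> and the distance of \<open>\<surd>2\<close> from the integers is \<open>\<lambda>\<close>.
\<close>

lemma no_other_crossing:
  fixes p :: int
  assumes m: "crossing i < m" "m < crossing (Suc i)"
  shows "\<bar>real m * sqrt 2 - left_end - of_int p\<bar> > silver ^ Suc m"
proof -
  obtain p0 :: int where p0: "real (crossing i) * sqrt 2 - left_end = of_int p0 + crossing_tail i"
    using crossing_orbit by blast
  define k where "k = int m - int (crossing i)"
  have k: "1 \<le> k" "k < conv_denom (sqrt 2) (crossing i + 2)"
    using m int_crossing_Suc[of i] by (auto simp: k_def)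
  have eq: "real m * sqrt 2 - left_end - of_int p
      = (of_int k * sqrt 2 - of_int (p - p0)) + crossing_tail i"
    using p0 by (simp add: k_def algebra_simps)
  have main: "\<bar>real m * sqrt 2 - left_end - of_int p\<bar>
      \<ge> \<bar>of_int k * sqrt 2 - of_int (p - p0)\<bar> - silver ^ (crossing i + 2) / 2"
    unfolding eq using crossing_tail_le[of i] crossing_tail_pos[of i] by linarith
  have pow: "silver ^ (crossing i + 2) > 0" by (rule silver_power_pos)
  show ?thesis
  proof (cases "m = Suc (crossing i)")
    case True
    then have "k = 1" by (simp add: k_def)
    moreover have "1 < conv_denom (sqrt 2) (Suc 0)" using cf_digit_sqrt2[of 0] by simp
    ultimately have "\<bar>of_int k * sqrt 2 - of_int (p - p0)\<bar> \<ge> silver"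
      using best_approximation[OF sqrt2_irrational, of 1 0 "p - p0"] conv_error_sqrt2[of 0] by simp
    moreover have "silver ^ (crossing i + 2) \<le> silver ^ 3"
      using crossing_pos[of i] by (intro silver_power_antimono) simp
    moreover have "silver ^ 3 = silver * silver\<^sup>2" by (simp add: eval_nat_numeral)
    moreover have "silver * silver\<^sup>2 < silver * (1 / 2)"
      using silver_bounds silver_square by (intro mult_strict_left_mono) auto
    moreover have "silver ^ Suc m = silver ^ (crossing i + 2)" using True by simp
    ultimately show ?thesis using main silver_bounds by linarith
  next
    case False
    have "conv_error (sqrt 2) (Suc (crossing i)) \<le> \<bar>of_int k * sqrt 2 - of_int (p - p0)\<bar>"
      using k by (intro best_approximation[OF sqrt2_irrational]) auto
    then have "\<bar>of_int k * sqrt 2 - of_int (p - p0)\<bar> \<ge> silver ^ (crossing i + 2)"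
      by (simp add: conv_error_sqrt2)
    moreover have "silver ^ Suc m \<le> silver ^ (crossing i + 3)"
      using m False by (intro silver_power_antimono) simp
    moreover have "silver ^ (crossing i + 3) = silver * silver ^ (crossing i + 2)"
      by (simp add: eval_nat_numeral)
    moreover have "silver * silver ^ (crossing i + 2) < 1 / 2 * silver ^ (crossing i + 2)"
      using silver_bounds pow by (intro mult_strict_right_mono) auto
    ultimately show ?thesis using main by linarith
  qed
qed

abbreviation orbit_frac :: "nat \<Rightarrow> real" where
  "orbit_frac n \<equiv> frac (real n * sqrt 2 - left_end)"

lemma orbit_frac_crossing: "orbit_frac (crossing i) = crossing_tail i"
proof -
  obtain p :: int where p: "real (crossing i) * sqrt 2 - left_end = of_int p + crossing_tail i"
    using crossing_orbit by blast
  have "silver ^ (crossing i + 2) \<le> silver ^ 0" by (intro silver_power_antimono) simp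
  then have "crossing_tail i < 1" using crossing_tail_le[of i] by simp
  then show ?thesis unfolding p using crossing_tail_pos[of i] by (simp add: frac_unique_iff)
qed

text \<open>
  Crossings of the left endpoint: at the times \<open>h\<^sub>i\<close> the point drops below it and its fractional part
  wraps around, which is recorded by the extra 1.
\<close>

lemma orbit_frac_perturbed_current:
  assumes "n \<ge> 1"
  shows "frac (real n * sqrt 2 - left_end + (-1) ^ n * silver ^ Suc n)
       = orbit_frac n + (-1) ^ n * silver ^ Suc n + of_bool (n \<in> range crossing)"
proof -
  obtain i where i: "crossing i \<le> n" "n < crossing (Suc i)" using between_crossings[OF assms] by blast
  show ?thesis
  proof (cases "n = crossing i")
    case True
    have "silver ^ (crossing i + 2) \<le> silver ^ Suc (crossing i)" by (intro silver_power_antimono) simp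
    then have tail: "crossing_tail i < silver ^ Suc (crossing i)"
      using crossing_tail_le[of i] silver_power_pos[of "crossing i + 2"] by linarith
    have one: "silver ^ Suc (crossing i) \<le> silver ^ 0" by (intro silver_power_antimono) simp
    have "frac (real n * sqrt 2 - left_end + (-1) ^ n * silver ^ Suc n)
        = frac (orbit_frac n + (-1) ^ n * silver ^ Suc n)" by simp
    also have "\<dots> = frac (crossing_tail i - silver ^ Suc (crossing i))"
      unfolding True orbit_frac_crossing using odd_crossing[of i] by simp
    also have "\<dots> = crossing_tail i - silver ^ Suc (crossing i) + 1"
      using tail one crossing_tail_pos[of i] by (simp add: frac_unique_iff)
    finally show ?thesis
      using odd_crossing[of i] orbit_frac_crossing[of i] True by simp
  next
    case False
    have "\<bar>(-1) ^ n * silver ^ Suc n\<bar> = silver ^ Suc n"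
      using silver_power_pos[of "Suc n"] by (simp add: abs_mult del: power_Suc)
    then have "frac (real n * sqrt 2 - left_end + (-1) ^ n * silver ^ Suc n)
        = orbit_frac n + (-1) ^ n * silver ^ Suc n"
      using no_other_crossing[of i n] i False by (intro frac_add_small) (simp del: crossing.simps power_Suc)
    moreover have "n \<notin> range crossing"
    proof
      assume "n \<in> range crossing"
      then obtain j where j: "n = crossing j" by blast
      show False
      proof (cases "j \<le> i")
        case True
        then show False using crossing_ge[of j "i - j"] i False j by simp
      next
        case False
        then show False using crossing_ge[of "Suc i" "j - Suc i"] i j by (simp del: crossing.simps)
      qed
    qed
    ultimately show ?thesis by simp
  qed
qed

text \<open>
  Crossings of the right endpoint. Modulo 1 it is \<open>a + \<surd>2\<close>, so that the position at time \<open>n + 1\<close>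
  relative to it is the position at time \<open>n\<close> relative to \<open>a\<close>, but with the displacement of time
  \<open>n + 1\<close>. At \<open>n = h\<^sub>i\<close> that displacement is upwards, away from the endpoint, so no wrap-around occurs
  even there.
\<close>

lemma orbit_frac_perturbed_previous:
  assumes "n \<ge> 1"
  shows "frac (real n * sqrt 2 - left_end + (-1) ^ Suc n * silver ^ Suc (Suc n))
       = orbit_frac n + (-1) ^ Suc n * silver ^ Suc (Suc n)"
proof -
  obtain i where i: "crossing i \<le> n" "n < crossing (Suc i)" using between_crossings[OF assms] by blast
  show ?thesis
  proof (cases "n = crossing i")
    case True
    have "silver ^ (crossing i + 2) \<le> silver" using silver_power_antimono[of 1 "crossing i + 2"] by simp
    then have lt: "crossing_tail i + silver ^ (crossing i + 2) < 1"
      using crossing_tail_le[of i] silver_bounds by linarith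
    have "frac (real n * sqrt 2 - left_end + (-1) ^ Suc n * silver ^ Suc (Suc n))
        = frac (orbit_frac n + (-1) ^ Suc n * silver ^ Suc (Suc n))" by (simp only: frac_add_simps)
    also have "\<dots> = frac (crossing_tail i + silver ^ (crossing i + 2))"
      unfolding True orbit_frac_crossing using odd_crossing[of i] by simp
    also have "\<dots> = crossing_tail i + silver ^ (crossing i + 2)"
      using lt crossing_tail_pos[of i] silver_power_pos[of "crossing i + 2"]
      by (simp add: frac_unique_iff del: power_Suc)
    finally show ?thesis
      using odd_crossing[of i] orbit_frac_crossing[of i] True by simp
  next
    case False
    have "silver ^ Suc (Suc n) \<le> silver ^ Suc n" by (intro silver_power_antimono) simp
    then have "\<bar>(-1) ^ Suc n * silver ^ Suc (Suc n)\<bar> \<le> silver ^ Suc n"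
      using silver_power_pos[of "Suc (Suc n)"] by (simp add: abs_mult del: power_Suc)
    then show ?thesis
      using le_less_trans[OF _ no_other_crossing[of i n]] i False
      by (intro frac_add_small) (simp del: crossing.simps power_Suc)
  qed
qed

text \<open>
  The interval has length \<open>\<surd>2\<close> modulo 1, so its two endpoints are one step of the orbit apart and
  the remainder telescopes.
\<close>

lemma bounded_remainder_orbit_sqrt2:
  "bounded_remainder (\<lambda>n. frac (real n * sqrt 2)) left_end (left_end + silver)"
proof -
  have "frac (real (Suc n) * sqrt 2 - (left_end + silver)) = orbit_frac n" for n
  proof -
    have "real (Suc n) * sqrt 2 - (left_end + silver) = (real n * sqrt 2 - left_end) + of_int 1"
      by (simp add: silver_def algebra_simps)
    then show ?thesis by (simp only: frac_add_of_int_right)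
  qed
  then have "(\<Sum>n=1..N. frac (real n * sqrt 2 - (left_end + silver))
      - frac (real n * sqrt 2 - left_end)) = orbit_frac 0 - orbit_frac N" for N
    by (induction N) auto
  moreover have "\<bar>orbit_frac 0 - orbit_frac N\<bar> \<le> 1" for N
    using frac_lt_1 frac_ge_0 by (smt (verit))
  ultimately show ?thesis
    unfolding bounded_remainder_frac_iff using left_end_bounds silver_bounds by auto
qed

text \<open>
  After adding the telescoping part back, the sum \<open>G N\<close> decreases by 1 at each \<open>h\<^sub>i\<close> with \<open>i \<ge> 1\<close> and
  is otherwise constant.
\<close>

lemma not_bounded_remainder_perturbed_orbit_sqrt2:
  "\<not> bounded_remainder (\<lambda>n. frac (real_of_int (conv_denom (sqrt 2) n + int n) * sqrt 2))
       left_end (left_end + silver)"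
proof
  let ?t = "\<lambda>n. real_of_int (conv_denom (sqrt 2) n + int n) * sqrt 2"
  let ?f = "\<lambda>n. frac (?t n - (left_end + silver)) - frac (?t n - left_end)"
  define G where "G N = (\<Sum>n=1..N. ?f n) + orbit_frac N" for N
  assume "bounded_remainder (\<lambda>n. frac (?t n)) left_end (left_end + silver)"
  then obtain c where c: "\<And>N. N \<ge> 1 \<Longrightarrow> \<bar>\<Sum>n=1..N. ?f n\<bar> \<le> c"
    unfolding bounded_remainder_frac_iff by blast
  have summand: "?f (Suc n) = orbit_frac n - orbit_frac (Suc n) - of_bool (Suc n \<in> range crossing)"
    if "n \<ge> 1" for n
  proof -
    have "?t (Suc n) - (left_end + silver)
        = (real n * sqrt 2 - left_end + (-1) ^ Suc n * silver ^ Suc (Suc n))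
          + of_int (conv_num (sqrt 2) (Suc n) + 1)"
      using conv_denom_sqrt2_mult[of "Suc n"] by (simp add: algebra_simps silver_def)
    moreover have "?t (Suc n) - left_end
        = (real (Suc n) * sqrt 2 - left_end + (-1) ^ Suc n * silver ^ Suc (Suc n))
          + of_int (conv_num (sqrt 2) (Suc n))"
      using conv_denom_sqrt2_mult[of "Suc n"] by (simp add: algebra_simps)
    ultimately have "?f (Suc n)
        = frac (real n * sqrt 2 - left_end + (-1) ^ Suc n * silver ^ Suc (Suc n))
          - frac (real (Suc n) * sqrt 2 - left_end + (-1) ^ Suc n * silver ^ Suc (Suc n))"
      by (simp only: frac_add_of_int_right)
    then show ?thesis
      using orbit_frac_perturbed_previous[of n] orbit_frac_perturbed_current[of "Suc n"] that
      by linarith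
  qed
  have G_Suc: "G (Suc n) = G n - of_bool (Suc n \<in> range crossing)" if "n \<ge> 1" for n
    using summand[OF that] by (simp add: G_def)
  have mono: "G N \<le> G M" if "1 \<le> M" "M \<le> N" for M N
    using that(2)
  proof (induction N rule: dec_induct)
    case (step n)
    then show ?case using G_Suc[of n] that(1) by simp
  qed auto
  have "G (crossing i) \<le> G 1 - real i" for i
  proof (induction i)
    case (Suc i)
    obtain n where n: "crossing (Suc i) = Suc n" "crossing i \<le> n" "1 \<le> n"
      using crossing_Suc_ge[of i] crossing_pos[of i] by (cases "crossing (Suc i)") auto
    have "G (crossing (Suc i)) = G n - 1"
      using G_Suc[of n] n by (metis of_bool_eq(2) rangeI)
    also have "G n \<le> G (crossing i)" using n crossing_pos by (intro mono)
    finally show ?case using Suc by simp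
  qed auto
  moreover have "G (crossing i) \<ge> - c" for i
    using c[of "crossing i"] crossing_pos[of i] frac_ge_0[of "real (crossing i) * sqrt 2 - left_end"]
    unfolding G_def by linarith
  ultimately have "real i \<le> G 1 + c" for i by (smt (verit))
  then show False using reals_Archimedean2[of "G 1 + c"] by (meson not_less)
qed

theorem theorem3:
  shows "(\<forall>\<alpha>::real. \<alpha> \<notin> \<rat> \<longrightarrow>
            uniformly_distributed_mod1 (\<lambda>n. frac (real_of_int (conv_denom \<alpha> n + int n) * \<alpha>)) \<and>
            (\<forall>k1 k2 :: nat. k1 \<ge> 1 \<and> k2 \<ge> 1 \<and> frac (real k1 * \<alpha>) < frac (real k2 * \<alpha>) \<longrightarrow>
               bounded_remainder (\<lambda>n. frac (real_of_int (conv_denom \<alpha> n + int n) * \<alpha>))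
                 (frac (real k1 * \<alpha>)) (frac (real k2 * \<alpha>)))) \<and>
         (\<exists>\<alpha>::real. \<alpha> \<notin> \<rat> \<and>
            bounded_remainder_intervals (\<lambda>n. frac (real_of_int (conv_denom \<alpha> n + int n) * \<alpha>)) \<noteq>
            bounded_remainder_intervals (\<lambda>n. frac (real n * \<alpha>)))"
proof (intro conjI allI impI exI[of _ "sqrt 2"])
  let ?I = "{left_end..<left_end + silver}"
  have "?I \<in> bounded_remainder_intervals (\<lambda>n. frac (real n * sqrt 2))"
    using bounded_remainder_orbit_sqrt2 by (auto simp: bounded_remainder_intervals_def)
  moreover have "?I \<notin> bounded_remainder_intervals
      (\<lambda>n. frac (real_of_int (conv_denom (sqrt 2) n + int n) * sqrt 2))"
  proof
    assume "?I \<in> bounded_remainder_intervals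
      (\<lambda>n. frac (real_of_int (conv_denom (sqrt 2) n + int n) * sqrt 2))"
    then obtain a b where ab: "?I = {a..<b}"
      "bounded_remainder (\<lambda>n. frac (real_of_int (conv_denom (sqrt 2) n + int n) * sqrt 2)) a b"
      unfolding bounded_remainder_intervals_def by blast
    moreover have "a < b" using ab(2) by (simp add: bounded_remainder_def)
    ultimately have "a = left_end" "b = left_end + silver"
      using silver_bounds by (auto simp: Ico_eq_Ico)
    then show False using ab(2) not_bounded_remainder_perturbed_orbit_sqrt2 by simp
  qed
  ultimately show "bounded_remainder_intervals
      (\<lambda>n. frac (real_of_int (conv_denom (sqrt 2) n + int n) * sqrt 2)) \<noteq>
      bounded_remainder_intervals (\<lambda>n. frac (real n * sqrt 2))" by blast
qed (use uniformly_distributed_perturbed_orbit bounded_remainder_perturbed_orbit sqrt2_irrational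
     in auto)

end
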